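(* Let $f\in\mathcal{S}^{*}_{e}$ with $f(z)=z+a_2z^2+a_3z^3+\cdots$. Then $$|H_4(1)|\le 0.29059,$$ where, with $a_1=1$, $$H_4(1)=\begin{vmatrix} a_1 & a_2 & a_3 & a_4 \\ a_2 & a_3 & a_4 & a_5 \\ a_3 & a_4 & a_5 & a_6 \\ a_4 & a_5 & a_6 & a_7 \end{vmatrix}.$$
   Context: Let $\mathbb{D}=\{z\in\mathbb{C}:|z|<1\}$ and let $\mathcal{A}$ be the set of analytic functions $f$ on $\mathbb{D}$ of the form $f(z)=z+a_2z^2+a_3z^3+\cdots$. For functions $h_1,h_2$ analytic on $\mathbb{D}$, $h_1\prec h_2$ ($h_1$ is subordinate to $h_2$) means that there is a Schwarz function $w$, i.e. an analytic $w$ on $\mathbb{D}$ with $w(0)=0$ and $|w(z)|\le|z|$, such that $h_1(z)=h_2(w(z))$ on $\mathbb{D}$. The class $\mathcal{S}^{*}_{e}$ is $$\mathcal{S}^{*}_{e}=\left\{f\in\mathcal{A}:\frac{zf'(z)}{f(z)}\prec e^{z}\right\}.$$ For $f\in\mathcal{A}$ with $a_1=1$, the Hankel determinant $H_q(n)$ is the determinant of the $q\times q$ matrix whose $(i,j)$ entry is $a_{n+i+j-2}$, $1\le i,j\le q$. *)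

theory Defs
  imports "HOL-Complex_Analysis.Complex_Analysis" "Jordan_Normal_Form.Determinant"
begin

abbreviation unit_disc :: "complex set" where
  "unit_disc \<equiv> ball 0 1"

(* The normalisation f(z) = z + a_2 z^2 + a_3 z^3 + ... is f(0) = 0, f'(0) = 1. *)
definition class_A :: "(complex \<Rightarrow> complex) set" where
  "class_A = {f. f holomorphic_on unit_disc \<and> f 0 = 0 \<and> deriv f 0 = 1}"

definition schwarz_function :: "(complex \<Rightarrow> complex) \<Rightarrow> bool" where
  "schwarz_function w \<longleftrightarrow>
     w holomorphic_on unit_disc \<and> w 0 = 0 \<and> (\<forall>z\<in>unit_disc. norm (w z) \<le> norm z)"

definition subordinate :: "(complex \<Rightarrow> complex) \<Rightarrow> (complex \<Rightarrow> complex) \<Rightarrow> bool" where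
  "subordinate h1 h2 \<longleftrightarrow>
     h1 holomorphic_on unit_disc \<and> h2 holomorphic_on unit_disc \<and>
     (\<exists>w. schwarz_function w \<and> (\<forall>z\<in>unit_disc. h1 z = h2 (w z)))"

(* z f'(z) / f(z) has a removable singularity at the origin for f in class_A, with value 1;
   HOL's 0 / 0 = 0 would give the wrong value there. *)
definition starlike_quotient :: "(complex \<Rightarrow> complex) \<Rightarrow> complex \<Rightarrow> complex" where
  "starlike_quotient f z = (if z = 0 then 1 else z * deriv f z / f z)"

(* Subordination to exp forces f to be nonzero on the punctured disc: at a zero of f the
   quotient above is 0 in HOL, which exp never attains. *)
definition class_S_star_e :: "(complex \<Rightarrow> complex) set" where
  "class_S_star_e = {f \<in> class_A. subordinate (starlike_quotient f) exp}"

definition taylor_coeff :: "(complex \<Rightarrow> complex) \<Rightarrow> nat \<Rightarrow> complex" where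
  "taylor_coeff f n = fps_nth (fps_expansion f 0) n"

(* Row and column indices of matrices start at 0 here, so the entry a_(n+i+j-2) for
   1 <= i, j <= q becomes a_(n+i+j). Determinant.det is the determinant of
   Jordan_Normal_Form, as opposed to the one of HOL-Analysis. *)
definition hankel_det :: "(nat \<Rightarrow> complex) \<Rightarrow> nat \<Rightarrow> nat \<Rightarrow> complex" where
  "hankel_det a q n = Determinant.det (Matrix.mat q q (\<lambda>(i, j). a (n + i + j)))"

lemma hankel_det_4_1:
  "hankel_det a 4 1 = Determinant.det (mat_of_rows_list 4
     [[a 1, a 2, a 3, a 4],
      [a 2, a 3, a 4, a 5],
      [a 3, a 4, a 5, a 6],
      [a 4, a 5, a 6, a 7]])"
proof -
  have "Matrix.mat 4 4 (\<lambda>(i, j). a (1 + i + j)) = mat_of_rows_list 4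
     [[a 1, a 2, a 3, a 4],
      [a 2, a 3, a 4, a 5],
      [a 3, a 4, a 5, a 6],
      [a 4, a 5, a 6, a 7]]"
    by (rule eq_matI)
       (auto simp: mat_of_rows_list_def less_Suc_eq numeral_eq_Suc)
  then show ?thesis
    by (simp only: hankel_det_def)
qed

lemma taylor_coeff_class_A:
  assumes "f \<in> class_A"
  shows "taylor_coeff f 0 = 0" and "taylor_coeff f 1 = 1"
    and "\<And>z. z \<in> unit_disc \<Longrightarrow> (\<lambda>n. taylor_coeff f n * z ^ n) sums f z"
proof -
  show "taylor_coeff f 0 = 0" and "taylor_coeff f 1 = 1"
    using assms by (simp_all add: class_A_def taylor_coeff_def fps_expansion_def)
  show "(\<lambda>n. taylor_coeff f n * z ^ n) sums f z" if "z \<in> unit_disc" for z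
    using holomorphic_power_series[of f 0 1 z] assms that
    by (simp add: class_A_def taylor_coeff_def fps_expansion_def)
qed

end

theory Submission
  imports Defs
begin

text \<open>
  Write \<open>z f'(z) / f(z) = exp (w z)\<close> with a Schwarz function \<open>w(z) = c\<^sub>1 z + c\<^sub>2 z\<^sup>2 + \<dots>\<close>.
  Comparing coefficients in \<open>z f' = f exp w\<close> expresses \<open>a\<^sub>2, \<dots>, a\<^sub>7\<close>, and with them the determinant
  \<open>H\<^sub>4(1)\<close>, as polynomials in \<open>c\<^sub>1, \<dots>, c\<^sub>6\<close>. Rotating \<open>f\<close> shows that \<open>H\<^sub>4(1)\<close> is homogeneous of weight
  12 if \<open>c\<^sub>k\<close> has weight \<open>k\<close>, so its monomials are indexed by partitions of 12. After all
  cancellations 54 of them remain (\<open>hankel_det_eq_sum_monomials\<close>), with small rational coefficients.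

  The estimate then needs nothing subtler than the triangle inequality and Bessel's inequality
  \<open>\<Sum> |c\<^sub>k|\<^sup>2 \<le> 1\<close> (\<open>bessel_bounded_holomorphic\<close>). The latter gives \<open>|c\<^sub>k| \<le> 1\<close>, and for \<open>j \<noteq> k\<close> also
  \<open>|c\<^sub>j c\<^sub>k| \<le> (|c\<^sub>j|\<^sup>2 + |c\<^sub>k|\<^sup>2) / 2 \<le> 1/2\<close>. Hence a monomial in which two different indices occur is
  at most \<open>1/2\<close> in modulus, and the powers of a single \<open>c\<^sub>k\<close> are at most \<open>1\<close>. The factor \<open>1/2\<close> is
  what makes the argument work: the absolute values of the 54 coefficients add up to about \<open>0.327\<close>,
  which exceeds the claimed bound, but all except three monomials are mixed, and the weighted sum
  is about \<open>0.173\<close>.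
\<close>

section \<open>Bessel's inequality for bounded analytic functions\<close>

text \<open>
  Cauchy's formula for the \<open>n\<close>-th derivative on the circle of radius \<open>r\<close>. There
  \<open>1 / z\<^sup>n = cnj (z\<^sup>n) / r\<^sup>2\<^sup>n\<close>, which turns the formula into an inner product with \<open>z\<^sup>n\<close>.
\<close>
lemma circle_coefficient_has_integral:
  assumes holo: "h holomorphic_on unit_disc" and r: "0 < r" "r < 1"
  shows "((\<lambda>t. h (circlepath 0 r t) * cnj (circlepath 0 r t ^ n)) has_integral
           taylor_coeff h n * of_real (r ^ (2 * n))) {0..1}"
proof -
  let ?g = "circlepath 0 r"
  have "h holomorphic_on cball 0 r"
    using holo r by (auto intro: holomorphic_on_subset)
  then have "((\<lambda>u. h u / (u - 0) ^ Suc n) has_contour_integral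
      (2 * pi * \<i>) / fact n * (deriv ^^ n) h 0) ?g"
    using r by (intro Cauchy_has_contour_integral_higher_derivative_circlepath)
      (auto intro: holomorphic_on_imp_continuous_on holomorphic_on_subset)
  then have "((\<lambda>t. h (?g t) / ?g t ^ Suc n * vector_derivative ?g (at t)) has_integral
      2 * pi * \<i> * taylor_coeff h n) {0..1}"
    by (simp add: has_contour_integral taylor_coeff_def fps_expansion_def)
  then have "((\<lambda>t. of_real (r ^ (2 * n)) / (2 * pi * \<i>) *
        (h (?g t) / ?g t ^ Suc n * vector_derivative ?g (at t))) has_integral
      of_real (r ^ (2 * n)) / (2 * pi * \<i>) * (2 * pi * \<i> * taylor_coeff h n)) {0..1}"
    by (rule has_integral_mult_right)
  moreover have "of_real (r ^ (2 * n)) / (2 * pi * \<i>) *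
        (h (?g t) / ?g t ^ Suc n * vector_derivative ?g (at t)) = h (?g t) * cnj (?g t ^ n)" for t
  proof -
    have nz: "?g t \<noteq> 0"
      using r by (simp add: circlepath)
    have "norm (?g t) = r"
      using r by (simp add: circlepath norm_mult)
    then have "?g t * cnj (?g t) = of_real (r ^ 2)"
      by (simp only: complex_norm_square [symmetric] of_real_power)
    then have "?g t ^ n * cnj (?g t ^ n) = of_real (r ^ (2 * n))"
      by (metis complex_cnj_power of_real_power power_mult power_mult_distrib)
    moreover have "vector_derivative ?g (at t) = 2 * pi * \<i> * ?g t"
      unfolding vector_derivative_circlepath by (simp add: circlepath)
    ultimately show ?thesis
      using nz by (simp add: field_simps)
  qed
  ultimately show ?thesis
    by (simp add: mult.commute)
qed

lemma taylor_coeff_sum_monomials: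
  assumes "finite S" "n \<in> S"
  shows "taylor_coeff (\<lambda>z. \<Sum>k\<in>S. b k * z ^ k) n = b n"
proof -
  have "(\<lambda>z. \<Sum>k\<in>S. b k * z ^ k) has_fps_expansion (\<Sum>k\<in>S. fps_const (b k) * fps_X ^ k)"
    by (intro fps_expansion_intros)
  then have "fps_expansion (\<lambda>z. \<Sum>k\<in>S. b k * z ^ k) 0 = (\<Sum>k\<in>S. fps_const (b k) * fps_X ^ k)"
    by (rule fps_expansion_eqI)
  then show ?thesis
    using assms by (simp add: taylor_coeff_def fps_sum_nth fps_X_power_nth if_distrib cong: if_cong)
qed

text \<open>
  Let \<open>P\<close> be the part of the Taylor series of \<open>h\<close> with exponents in \<open>S\<close>, and \<open>B\<close> the sum in question
  with the factors \<open>r\<^sup>2\<^sup>k\<close>. On the circle of radius \<open>r < 1\<close> both \<open>\<langle>h, P\<rangle>\<close> and \<open>\<langle>P, P\<rangle>\<close> equal \<open>B\<close>,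
  because only the coefficients with index in \<open>S\<close> enter and these agree. Integrating the pointwise
  inequality \<open>2 Re (h cnj P) - |P|\<^sup>2 = |h|\<^sup>2 - |h - P|\<^sup>2 \<le> 1\<close> gives \<open>2 B - B \<le> 1\<close>; then \<open>r\<close> tends to 1.
\<close>
lemma bessel_bounded_holomorphic:
  assumes holo: "h holomorphic_on unit_disc"
    and bound: "\<And>z. z \<in> unit_disc \<Longrightarrow> norm (h z) \<le> 1"
    and "finite S"
  shows "(\<Sum>k\<in>S. (norm (taylor_coeff h k))\<^sup>2) \<le> 1"
proof -
  let ?c = "taylor_coeff h"
  define P where "P z = (\<Sum>k\<in>S. ?c k * z ^ k)" for z
  have holoP: "P holomorphic_on unit_disc"
    unfolding P_def by (intro holomorphic_intros)
  have circle: "(\<Sum>k\<in>S. (norm (?c k))\<^sup>2 * r ^ (2 * k)) \<le> 1" if r: "0 < r" "r < 1" for r :: real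
  proof -
    let ?g = "circlepath 0 r"
    let ?B = "\<Sum>k\<in>S. (norm (?c k))\<^sup>2 * r ^ (2 * k)"
    have inner: "((\<lambda>t. u (?g t) * cnj (P (?g t))) has_integral of_real ?B) {0..1}"
      if u: "u holomorphic_on unit_disc" "\<And>k. k \<in> S \<Longrightarrow> taylor_coeff u k = ?c k" for u
    proof -
      have "((\<lambda>t. \<Sum>k\<in>S. cnj (?c k) * (u (?g t) * cnj (?g t ^ k))) has_integral
          (\<Sum>k\<in>S. cnj (?c k) * (taylor_coeff u k * of_real (r ^ (2 * k))))) {0..1}"
        using u(1) r \<open>finite S\<close>
        by (intro has_integral_sum has_integral_mult_right circle_coefficient_has_integral)
      moreover have "(\<Sum>k\<in>S. cnj (?c k) * (taylor_coeff u k * of_real (r ^ (2 * k)))) = of_real ?B"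
        by (simp only: of_real_sum of_real_mult complex_norm_square)
          (intro sum.cong refl, simp add: u(2) mult_ac)
      moreover have "(\<lambda>t. \<Sum>k\<in>S. cnj (?c k) * (u (?g t) * cnj (?g t ^ k))) =
          (\<lambda>t. u (?g t) * cnj (P (?g t)))"
        by (simp add: P_def sum_distrib_left mult_ac)
      ultimately show ?thesis
        by simp
    qed
    have "((\<lambda>t. h (?g t) * cnj (P (?g t))) has_integral of_real ?B) {0..1}"
      by (rule inner) (use holo in auto)
    moreover have "((\<lambda>t. P (?g t) * cnj (P (?g t))) has_integral of_real ?B) {0..1}"
      by (rule inner [OF holoP]) (simp add: P_def [abs_def] taylor_coeff_sum_monomials \<open>finite S\<close>)
    ultimately have "((\<lambda>t. 2 * (h (?g t) * cnj (P (?g t))) - P (?g t) * cnj (P (?g t)))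
        has_integral (2 * of_real ?B - of_real ?B)) {0..1}"
      by (intro has_integral_diff has_integral_mult_right)
    then have "((\<lambda>t. Re (2 * (h (?g t) * cnj (P (?g t))) - P (?g t) * cnj (P (?g t))))
        has_integral Re (2 * of_real ?B - of_real ?B)) {0..1}"
      by (rule has_integral_Re)
    then have *: "((\<lambda>t. Re (2 * (h (?g t) * cnj (P (?g t))) - P (?g t) * cnj (P (?g t))))
        has_integral ?B) {0..1}"
      by simp
    have "Re (2 * (h (?g t) * cnj (P (?g t))) - P (?g t) * cnj (P (?g t))) \<le> 1" for t
    proof -
      have "norm (?g t) < 1"
        using r by (simp add: circlepath norm_mult)
      then have "norm (h (?g t)) \<le> 1"
        by (intro bound) simp
      then have "(norm (h (?g t)))\<^sup>2 \<le> 1"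
        by (simp add: power_le_one)
      moreover have "Re (2 * (h (?g t) * cnj (P (?g t))) - P (?g t) * cnj (P (?g t))) =
          (norm (h (?g t)))\<^sup>2 - (norm (h (?g t) - P (?g t)))\<^sup>2"
        unfolding cmod_power2 by (simp add: power2_eq_square algebra_simps)
      ultimately show ?thesis
        using zero_le_power2 [of "norm (h (?g t) - P (?g t))"] by linarith
    qed
    with * have "?B \<le> 1"
      using has_integral_le [OF * has_integral_const_real [of 1 0 1]] by simp
    then show ?thesis .
  qed
  have "((\<lambda>r. \<Sum>k\<in>S. (norm (?c k))\<^sup>2 * r ^ (2 * k)) \<longlongrightarrow>
      (\<Sum>k\<in>S. (norm (?c k))\<^sup>2 * 1 ^ (2 * k))) (at_left (1::real))"
    by (intro tendsto_intros)
  moreover have "\<forall>\<^sub>F r in at_left (1::real). (\<Sum>k\<in>S. (norm (?c k))\<^sup>2 * r ^ (2 * k)) \<le> 1"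
    by (rule eventually_mono [OF eventually_at_left_real [of 0 1]]) (auto intro: circle)
  ultimately show ?thesis
    by (auto dest: tendsto_upperbound)
qed

section \<open>Monomials in the coefficients of a Schwarz function\<close>

text \<open>
  A monomial is the list of its indices with repetitions, so \<open>[3, 3, 6]\<close> stands for \<open>c\<^sub>3\<^sup>2 c\<^sub>6\<close>: the
  weight is then the sum of the list.
\<close>
definition monomial :: "(nat \<Rightarrow> 'a::comm_monoid_mult) \<Rightarrow> nat list \<Rightarrow> 'a" where
  "monomial c ks = prod_list (map c ks)"

text \<open>
  Two different indices are detected by comparing the ends of the list, which for a sorted list
  finds every mixed monomial; the empty list is set apart because its ends are unspecified. The
  factors at the two ends contribute \<open>1/2\<close>, the others at most 1.
\<close>
lemma norm_monomial_le:
  fixes c :: "nat \<Rightarrow> 'a::real_normed_field"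
  assumes bessel: "\<And>j k. j \<noteq> k \<Longrightarrow> (norm (c j))\<^sup>2 + (norm (c k))\<^sup>2 \<le> 1"
  shows "norm (monomial c ks) \<le> (if ks \<noteq> [] \<and> hd ks \<noteq> last ks then 1 / 2 else 1)"
proof -
  have le1: "norm (c k) \<le> 1" for k
  proof -
    have "(norm (c k))\<^sup>2 \<le> 1"
      using bessel [of k "Suc k"] zero_le_power2 [of "norm (c (Suc k))"] by linarith
    then show ?thesis
      using abs_square_le_1 [of "norm (c k)"] by simp
  qed
  have mon1: "norm (monomial c ls) \<le> 1" for ls
    by (induction ls) (auto simp: monomial_def norm_mult intro: mult_le_one le1)
  show ?thesis
  proof (cases "ks \<noteq> [] \<and> hd ks \<noteq> last ks")
    case True
    then have distinct: "hd ks \<noteq> last ks"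
      by simp
    with True have "tl ks \<noteq> []"
      by (cases ks) auto
    then obtain ls where ks: "ks = hd ks # ls @ [last ks]"
      by (metis append_butlast_last_id last_tl list.collapse tl_Nil)
    let ?x = "norm (c (hd ks))" and ?y = "norm (c (last ks))"
    have "monomial c ks = c (hd ks) * c (last ks) * monomial c ls"
      by (subst ks) (simp add: monomial_def mult_ac)
    then have "norm (monomial c ks) \<le> ?x * ?y"
      using mon1 [of ls] by (simp add: norm_mult mult_left_le)
    also have "\<dots> \<le> 1 / 2"
      using bessel [OF distinct] sum_squares_bound [of ?x ?y] by linarith
    finally show ?thesis
      using True by simp
  qed (use mon1 in auto)
qed

lemma norm_sum_monomials_le:
  fixes c :: "nat \<Rightarrow> 'a::real_normed_field" and T :: "(real \<times> nat list) list"
  assumes "\<And>j k. j \<noteq> k \<Longrightarrow> (norm (c j))\<^sup>2 + (norm (c k))\<^sup>2 \<le> 1"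
  shows "norm (\<Sum>(q, ks)\<leftarrow>T. of_real q * monomial c ks)
      \<le> (\<Sum>(q, ks)\<leftarrow>T. \<bar>q\<bar> * (if ks \<noteq> [] \<and> hd ks \<noteq> last ks then 1 / 2 else 1))"
proof (induction T)
  case (Cons t T)
  obtain q ks where t: "t = (q, ks)"
    by force
  have "norm (of_real q * monomial c ks) \<le> \<bar>q\<bar> * (if ks \<noteq> [] \<and> hd ks \<noteq> last ks then 1 / 2 else 1)"
    unfolding norm_mult norm_of_real
    by (intro mult_left_mono norm_monomial_le assms) auto
  with Cons.IH show ?case
    unfolding t list.map sum_list.Cons case_prod_conv by (intro norm_triangle_le add_mono)
qed simp

section \<open>The coefficients of a function in the class\<close>

text \<open>
  The function \<open>exp (w z)\<close> enters only through its power series \<open>E\<close>, determined by \<open>E' = w' E\<close> and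
  \<open>E(0) = 1\<close>; this linear equation yields a recurrence for the coefficients of \<open>E\<close> directly.
\<close>
lemma quotient_eq_exp_power_series:
  assumes holf: "f holomorphic_on unit_disc" and holw: "w holomorphic_on unit_disc"
    and "w 0 = 0"
    and eq: "\<And>z. z \<in> unit_disc \<Longrightarrow> z * deriv f z = f z * exp (w z)"
  obtains E where "fps_nth E 0 = 1"
    and "fps_deriv E = fps_deriv (fps_expansion w 0) * E"
    and "fps_X * fps_deriv (fps_expansion f 0) = fps_expansion f 0 * E"
proof -
  let ?E = "fps_expansion (\<lambda>z. exp (w z)) 0"
  have near: "\<forall>\<^sub>F z in nhds 0. z \<in> unit_disc"
    by (rule eventually_nhds_in_open) auto
  have F: "f has_fps_expansion fps_expansion f 0"
    and W: "w has_fps_expansion fps_expansion w 0"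
    and E: "(\<lambda>z. exp (w z)) has_fps_expansion ?E"
    using holf holw
    by (auto intro!: has_fps_expansion_fps_expansion [of unit_disc] holomorphic_intros)
  have "deriv (\<lambda>z. exp (w z)) z = deriv w z * exp (w z)" if "z \<in> unit_disc" for z
  proof -
    have "(w has_field_derivative deriv w z) (at z)"
      using holomorphic_derivI [OF holw _ that] by simp
    then have "((\<lambda>z. exp (w z)) has_field_derivative deriv w z * exp (w z)) (at z)"
      by (auto intro!: derivative_eq_intros)
    then show ?thesis
      by (rule DERIV_imp_deriv)
  qed
  then have "\<forall>\<^sub>F z in nhds 0. deriv (\<lambda>z. exp (w z)) z = deriv w z * exp (w z)"
    using near by (auto elim: eventually_mono)
  then have "deriv (\<lambda>z. exp (w z)) has_fps_expansion fps_deriv (fps_expansion w 0) * ?E"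
    using has_fps_expansion_mult [OF has_fps_expansion_deriv [OF W] E]
    by (subst has_fps_expansion_cong) auto
  with has_fps_expansion_deriv [OF E]
  have deriv_E: "fps_deriv ?E = fps_deriv (fps_expansion w 0) * ?E"
    by (rule fps_expansion_unique_complex)
  have "\<forall>\<^sub>F z in nhds 0. z * deriv f z = f z * exp (w z)"
    using near by (auto elim: eventually_mono simp: eq)
  then have "(\<lambda>z. z * deriv f z) has_fps_expansion fps_expansion f 0 * ?E"
    using has_fps_expansion_mult [OF F E] by (subst has_fps_expansion_cong) auto
  moreover have "(\<lambda>z. z * deriv f z) has_fps_expansion fps_X * fps_deriv (fps_expansion f 0)"
    by (intro fps_expansion_intros F)
  ultimately have "fps_X * fps_deriv (fps_expansion f 0) = fps_expansion f 0 * ?E"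
    by (intro fps_expansion_unique_complex)
  moreover have "fps_nth ?E 0 = 1"
    using \<open>w 0 = 0\<close> by (simp add: fps_expansion_def)
  ultimately show ?thesis
    using that deriv_E by blast
qed

text \<open>
  Comparing coefficients gives the linear recurrences \<open>n p\<^sub>n = \<Sum> k c\<^sub>k p\<^sub>n\<^sub>-\<^sub>k\<close> for the coefficients
  \<open>p\<^sub>n\<close> of \<open>E\<close>, and \<open>n a\<^sub>n\<^sub>+\<^sub>1 = \<Sum> p\<^sub>k a\<^sub>n\<^sub>+\<^sub>1\<^sub>-\<^sub>k\<close>, both with \<open>1 \<le> k \<le> n\<close>; in the second, the
  term with \<open>p\<^sub>0 = 1\<close> has been moved to the left. They are solved one after the other.
\<close>
lemma quotient_eq_exp_coefficients:
  fixes F W E :: "complex fps"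
  defines "a \<equiv> fps_nth F" and "c \<equiv> fps_nth W"
  assumes a01: "a 0 = 0" "a 1 = 1" and E0: "fps_nth E 0 = 1"
    and dE: "fps_deriv E = fps_deriv W * E" and dF: "fps_X * fps_deriv F = F * E"
  shows "a 2 = c 1"
    and "a 3 = 1 / 2 * c 2 + 3 / 4 * c 1^2"
    and "a 4 = 1 / 3 * c 3 + 5 / 6 * c 1 * c 2 + 17 / 36 * c 1^3"
    and "a 5 = 1 / 4 * c 4 + 1 / 4 * c 2^2 + 7 / 12 * c 1 * c 3 + 5 / 6 * c 1^2 * c 2
      + 19 / 72 * c 1^4"
    and "a 6 = 1 / 5 * c 5 + 11 / 30 * c 2 * c 3 + 9 / 20 * c 1 * c 4 + 31 / 60 * c 1 * c 2^2
      + 3 / 5 * c 1^2 * c 3 + 29 / 45 * c 1^3 * c 2 + 27 / 200 * c 1^5"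
    and "a 7 = 1 / 6 * c 6 + 5 / 36 * c 3^2 + 7 / 24 * c 2 * c 4 + 1 / 9 * c 2^3
      + 11 / 30 * c 1 * c 5 + 277 / 360 * c 1 * c 2 * c 3 + 113 / 240 * c 1^2 * c 4
      + 221 / 360 * c 1^2 * c 2^2 + 1021 / 2160 * c 1^3 * c 3 + 1829 / 4320 * c 1^4 * c 2
      + 8351 / 129600 * c 1^6"
proof -
  define p where "p = fps_nth E"
  have p0: "p 0 = 1"
    using E0 by (simp add: p_def)
  have p_rec: "of_nat (Suc n) * p (Suc n) = (\<Sum>i\<le>n. of_nat (Suc i) * c (Suc i) * p (n - i))" for n
    using arg_cong [OF dE, of "\<lambda>G. fps_nth G n"]
    by (simp add: fps_mult_nth p_def c_def atMost_atLeast0)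
  have a_rec: "of_nat (Suc n) * a (Suc n) = (\<Sum>i\<le>Suc n. a i * p (Suc n - i))" for n
    using arg_cong [OF dF, of "\<lambda>G. fps_nth G (Suc n)"]
    by (simp add: fps_mult_nth [of F] p_def a_def atMost_atLeast0)
  have p1: "p 1 = c 1"
    using p_rec [of 0] by (simp add: numeral_eq_Suc p0)
  have p2_rec: "2 * p 2 = c 1 * p 1 + 2 * c 2"
    using p_rec [of 1] by (simp add: numeral_eq_Suc p0)
  \<comment> \<open>The qualified name selects the normaliser for polynomial identities; \<open>algebra\<close> alone denotes
    the method for algebraic structures with explicit carriers.\<close>
  have p2: "p 2 = c 2 + 1 / 2 * c 1^2"
    using p2_rec unfolding p1 by Groebner_Basis.algebra
  have p3_rec: "3 * p 3 = c 1 * p 2 + 2 * c 2 * p 1 + 3 * c 3"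
    using p_rec [of 2] by (simp add: numeral_eq_Suc p0)
  have p3: "p 3 = c 3 + c 1 * c 2 + 1 / 6 * c 1^3"
    using p3_rec unfolding p1 p2 by Groebner_Basis.algebra
  have p4_rec: "4 * p 4 = c 1 * p 3 + 2 * c 2 * p 2 + 3 * c 3 * p 1 + 4 * c 4"
    using p_rec [of 3] by (simp add: numeral_eq_Suc p0)
  have p4: "p 4 = c 4 + 1 / 2 * c 2^2 + c 1 * c 3 + 1 / 2 * c 1^2 * c 2 + 1 / 24 * c 1^4"
    using p4_rec unfolding p1 p2 p3 by Groebner_Basis.algebra
  have p5_rec: "5 * p 5 = c 1 * p 4 + 2 * c 2 * p 3 + 3 * c 3 * p 2 + 4 * c 4 * p 1 + 5 * c 5"
    using p_rec [of 4] by (simp add: numeral_eq_Suc p0)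
  have p5: "p 5 = c 5 + c 2 * c 3 + c 1 * c 4 + 1 / 2 * c 1 * c 2^2 + 1 / 2 * c 1^2 * c 3
      + 1 / 6 * c 1^3 * c 2 + 1 / 120 * c 1^5"
    using p5_rec unfolding p1 p2 p3 p4 by Groebner_Basis.algebra
  have p6_rec: "6 * p 6 = c 1 * p 5 + 2 * c 2 * p 4 + 3 * c 3 * p 3 + 4 * c 4 * p 2 + 5 * c 5 * p 1 + 6 * c 6"
    using p_rec [of 5] by (simp add: numeral_eq_Suc p0)
  have p6: "p 6 = c 6 + 1 / 2 * c 3^2 + c 2 * c 4 + 1 / 6 * c 2^3 + c 1 * c 5 + c 1 * c 2 * c 3
      + 1 / 2 * c 1^2 * c 4 + 1 / 4 * c 1^2 * c 2^2 + 1 / 6 * c 1^3 * c 3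
      + 1 / 24 * c 1^4 * c 2 + 1 / 720 * c 1^6"
    using p6_rec unfolding p1 p2 p3 p4 p5 by Groebner_Basis.algebra
  note a1 = a01(2) [unfolded One_nat_def]
  show a2: "a 2 = c 1"
    using a_rec [of 1] p1 by (simp add: numeral_eq_Suc p0 a01(1) a1 algebra_simps)
  have a3_rec: "2 * a 3 = p 1 * a 2 + p 2"
    using a_rec [of 2] by (simp add: numeral_eq_Suc p0 a01(1) a1 algebra_simps)
  show a3: "a 3 = 1 / 2 * c 2 + 3 / 4 * c 1^2"
    using a3_rec unfolding p1 p2 a2 by Groebner_Basis.algebra
  have a4_rec: "3 * a 4 = p 1 * a 3 + p 2 * a 2 + p 3"
    using a_rec [of 3] by (simp add: numeral_eq_Suc p0 a01(1) a1 algebra_simps)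
  show a4: "a 4 = 1 / 3 * c 3 + 5 / 6 * c 1 * c 2 + 17 / 36 * c 1^3"
    using a4_rec unfolding p1 p2 p3 a2 a3 by Groebner_Basis.algebra
  have a5_rec: "4 * a 5 = p 1 * a 4 + p 2 * a 3 + p 3 * a 2 + p 4"
    using a_rec [of 4] by (simp add: numeral_eq_Suc p0 a01(1) a1 algebra_simps)
  show a5: "a 5 = 1 / 4 * c 4 + 1 / 4 * c 2^2 + 7 / 12 * c 1 * c 3 + 5 / 6 * c 1^2 * c 2
      + 19 / 72 * c 1^4"
    using a5_rec unfolding p1 p2 p3 p4 a2 a3 a4 by Groebner_Basis.algebra
  have a6_rec: "5 * a 6 = p 1 * a 5 + p 2 * a 4 + p 3 * a 3 + p 4 * a 2 + p 5"
    using a_rec [of 5] by (simp add: numeral_eq_Suc p0 a01(1) a1 algebra_simps)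
  show a6: "a 6 = 1 / 5 * c 5 + 11 / 30 * c 2 * c 3 + 9 / 20 * c 1 * c 4 + 31 / 60 * c 1 * c 2^2
      + 3 / 5 * c 1^2 * c 3 + 29 / 45 * c 1^3 * c 2 + 27 / 200 * c 1^5"
    using a6_rec unfolding p1 p2 p3 p4 p5 a2 a3 a4 a5 by Groebner_Basis.algebra
  have a7_rec: "6 * a 7 = p 1 * a 6 + p 2 * a 5 + p 3 * a 4 + p 4 * a 3 + p 5 * a 2 + p 6"
    using a_rec [of 6] by (simp add: numeral_eq_Suc p0 a01(1) a1 algebra_simps)
  show a7: "a 7 = 1 / 6 * c 6 + 5 / 36 * c 3^2 + 7 / 24 * c 2 * c 4 + 1 / 9 * c 2^3
      + 11 / 30 * c 1 * c 5 + 277 / 360 * c 1 * c 2 * c 3 + 113 / 240 * c 1^2 * c 4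
      + 221 / 360 * c 1^2 * c 2^2 + 1021 / 2160 * c 1^3 * c 3 + 1829 / 4320 * c 1^4 * c 2
      + 8351 / 129600 * c 1^6"
    using a7_rec unfolding p1 p2 p3 p4 p5 p6 a2 a3 a4 a5 a6 by Groebner_Basis.algebra
qed

section \<open>The Hankel determinant\<close>

text \<open>
  Laplace expansion along the first row, in a form that rewriting can iterate: the minors are again
  matrices given by an entry function.
\<close>
lemma det_mat_Suc:
  fixes g :: "nat \<times> nat \<Rightarrow> 'a::comm_ring_1"
  shows "Determinant.det (Matrix.mat (Suc n) (Suc n) g) = (\<Sum>j<Suc n. (- 1) ^ j * g (0, j) *
    Determinant.det (Matrix.mat n n (\<lambda>(i, k). g (Suc i, if k < j then k else Suc k))))"
proof -
  let ?A = "Matrix.mat (Suc n) (Suc n) g"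
  have "mat_delete ?A 0 j = Matrix.mat n n (\<lambda>(i, k). g (Suc i, if k < j then k else Suc k))"
    if "j < Suc n" for j
    using that by (intro eq_matI) (auto simp: mat_delete_def)
  then show ?thesis
    by (subst laplace_expansion_row [of ?A "Suc n" 0])
      (auto simp: cofactor_def mult_ac intro!: sum.cong)
qed

lemma hankel_det_4_1_expand:
  "hankel_det a 4 1 =
     a 1 * (a 3 * (a 5 * a 7 - a 6^2) - a 4 * (a 4 * a 7 - a 5 * a 6) + a 5 * (a 4 * a 6 - a 5^2))
   - a 2 * (a 2 * (a 5 * a 7 - a 6^2) - a 4 * (a 3 * a 7 - a 4 * a 6) + a 5 * (a 3 * a 6 - a 4 * a 5))
   + a 3 * (a 2 * (a 4 * a 7 - a 5 * a 6) - a 3 * (a 3 * a 7 - a 4 * a 6) + a 5 * (a 3 * a 5 - a 4^2))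
   - a 4 * (a 2 * (a 4 * a 6 - a 5^2) - a 3 * (a 3 * a 6 - a 4 * a 5) + a 4 * (a 3 * a 5 - a 4^2))"
proof -
  have "Matrix.mat 4 4 (\<lambda>(i, j). a (1 + i + j)) =
      Matrix.mat (Suc (Suc (Suc (Suc 0)))) (Suc (Suc (Suc (Suc 0)))) (\<lambda>(i, j). a (1 + i + j))"
    by (simp add: numeral_eq_Suc)
  then show ?thesis
    unfolding hankel_det_def
    by (simp add: det_mat_Suc) (simp add: numeral_eq_Suc power2_eq_square algebra_simps)
qed

text \<open>
  The expansion of \<open>H\<^sub>4(1)\<close> in the coefficients of the Schwarz function, as partitions of 12 paired
  with the coefficients of their monomials. The parts are sorted, so that the comparison of the ends in
  \<open>norm_monomial_le\<close> recognises every mixed monomial.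
\<close>
definition hankel_terms :: "(real \<times> nat list) list" where
  "hankel_terms =
    [(-1/64, [4, 4, 4]), (1/30, [3, 4, 5]), (-1/54, [3, 3, 6]), (-1/324, [3, 3, 3, 3]),
     (-1/50, [2, 5, 5]), (1/48, [2, 4, 6]), (19/4320, [2, 3, 3, 4]),
     (1/192, [2, 2, 4, 4]), (-1/150, [2, 2, 3, 5]), (2/2025, [2, 2, 2, 3, 3]),
     (-1/576, [2, 2, 2, 2, 4]), (7/960, [1, 3, 4, 4]), (-1/135, [1, 3, 3, 5]),
     (-13/1200, [1, 2, 4, 5]), (5/432, [1, 2, 3, 6]), (149/12960, [1, 2, 3, 3, 3]),
     (-479/21600, [1, 2, 2, 3, 4]), (1/75, [1, 2, 2, 2, 5]),
     (163/129600, [1, 2, 2, 2, 2, 3]), (1/100, [1, 1, 5, 5]), (-1/96, [1, 1, 4, 6]),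
     (-1/108, [1, 1, 3, 3, 4]), (11/1200, [1, 1, 2, 4, 4]), (19/2160, [1, 1, 2, 3, 5]),
     (-5/432, [1, 1, 2, 2, 6]), (-13/4800, [1, 1, 2, 2, 3, 3]),
     (-11/10800, [1, 1, 2, 2, 2, 4]), (-163/129600, [1, 1, 2, 2, 2, 2, 2]),
     (-41/7200, [1, 1, 1, 4, 5]), (17/2592, [1, 1, 1, 3, 6]),
     (211/38880, [1, 1, 1, 3, 3, 3]), (-19/6480, [1, 1, 1, 2, 3, 4]),
     (1/10800, [1, 1, 1, 2, 2, 5]), (287/97200, [1, 1, 1, 2, 2, 2, 3]),
     (49/14400, [1, 1, 1, 1, 4, 4]), (-397/64800, [1, 1, 1, 1, 3, 5]),
     (13/5184, [1, 1, 1, 1, 2, 6]), (-1189/259200, [1, 1, 1, 1, 2, 3, 3]),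
     (277/129600, [1, 1, 1, 1, 2, 2, 4]), (149/1555200, [1, 1, 1, 1, 2, 2, 2, 2]),
     (91/64800, [1, 1, 1, 1, 1, 3, 4]), (-61/648000, [1, 1, 1, 1, 1, 2, 5]),
     (133/216000, [1, 1, 1, 1, 1, 2, 2, 3]), (-13/31104, [1, 1, 1, 1, 1, 1, 6]),
     (97/1555200, [1, 1, 1, 1, 1, 1, 3, 3]), (-2173/1944000, [1, 1, 1, 1, 1, 1, 2, 4]),
     (-3139/11664000, [1, 1, 1, 1, 1, 1, 2, 2, 2]),
     (1213/3888000, [1, 1, 1, 1, 1, 1, 1, 5]), (13/48600, [1, 1, 1, 1, 1, 1, 1, 2, 3]),
     (-253/15552000, [1, 1, 1, 1, 1, 1, 1, 1, 4]),
     (353/10368000, [1, 1, 1, 1, 1, 1, 1, 1, 2, 2]),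
     (-3401/139968000, [1, 1, 1, 1, 1, 1, 1, 1, 1, 3]),
     (-2729/1399680000, [1, 1, 1, 1, 1, 1, 1, 1, 1, 1, 2]),
     (2729/16796160000, [1, 1, 1, 1, 1, 1, 1, 1, 1, 1, 1, 1])]"

text \<open>
  An identity of polynomials in six variables: once the coefficients are substituted, normalising
  both sides proves it.
\<close>
lemma hankel_det_eq_sum_monomials:
  fixes a c :: "nat \<Rightarrow> complex"
  assumes "a 1 = 1"
    and "a 2 = c 1"
    and "a 3 = 1 / 2 * c 2 + 3 / 4 * c 1^2"
    and "a 4 = 1 / 3 * c 3 + 5 / 6 * c 1 * c 2 + 17 / 36 * c 1^3"
    and "a 5 = 1 / 4 * c 4 + 1 / 4 * c 2^2 + 7 / 12 * c 1 * c 3 + 5 / 6 * c 1^2 * c 2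
      + 19 / 72 * c 1^4"
    and "a 6 = 1 / 5 * c 5 + 11 / 30 * c 2 * c 3 + 9 / 20 * c 1 * c 4 + 31 / 60 * c 1 * c 2^2
      + 3 / 5 * c 1^2 * c 3 + 29 / 45 * c 1^3 * c 2 + 27 / 200 * c 1^5"
    and "a 7 = 1 / 6 * c 6 + 5 / 36 * c 3^2 + 7 / 24 * c 2 * c 4 + 1 / 9 * c 2^3
      + 11 / 30 * c 1 * c 5 + 277 / 360 * c 1 * c 2 * c 3 + 113 / 240 * c 1^2 * c 4
      + 221 / 360 * c 1^2 * c 2^2 + 1021 / 2160 * c 1^3 * c 3 + 1829 / 4320 * c 1^4 * c 2
      + 8351 / 129600 * c 1^6"
  shows "hankel_det a 4 1 = (\<Sum>(q, ks)\<leftarrow>hankel_terms. of_real q * monomial c ks)"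
  unfolding hankel_det_4_1_expand assms hankel_terms_def monomial_def
    list.map sum_list.Cons sum_list.Nil prod_list.Cons prod_list.Nil case_prod_conv
    of_real_divide of_real_minus of_real_numeral of_real_1
  by Groebner_Basis.algebra

lemma sum_weights_hankel_terms:
  "(\<Sum>(q, ks)\<leftarrow>hankel_terms. \<bar>q\<bar> * (if ks \<noteq> [] \<and> hd ks \<noteq> last ks then 1 / 2 else 1)) \<le> 7 / 40"
  by (simp add: hankel_terms_def)

section \<open>The estimate\<close>

theorem theorem2p7:
  fixes f :: "complex \<Rightarrow> complex"
  assumes "f \<in> class_S_star_e"
  shows "norm (hankel_det (taylor_coeff f) 4 1) \<le> (0.29059 :: real)"
proof -
  have A: "f \<in> class_A" and "subordinate (starlike_quotient f) exp"
    using assms by (auto simp: class_S_star_e_def)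
  then obtain w where "schwarz_function w"
    and quotient: "\<And>z. z \<in> unit_disc \<Longrightarrow> starlike_quotient f z = exp (w z)"
    unfolding subordinate_def by blast
  then have holw: "w holomorphic_on unit_disc" and w0: "w 0 = 0"
    and w_le: "\<And>z. z \<in> unit_disc \<Longrightarrow> norm (w z) \<le> norm z"
    by (auto simp: schwarz_function_def)
  have holf: "f holomorphic_on unit_disc" and f0: "f 0 = 0"
    using A by (auto simp: class_A_def)
  let ?a = "taylor_coeff f" and ?c = "taylor_coeff w"

  have "z * deriv f z = f z * exp (w z)" if z: "z \<in> unit_disc" for z
  proof (cases "z = 0")
    case False
    then have eq: "z * deriv f z / f z = exp (w z)"
      using quotient [OF z] by (simp add: starlike_quotient_def)
    \<comment> \<open>At a zero of \<open>f\<close> the quotient is 0 by convention, a value that \<open>exp\<close> omits.\<close>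
    then have "f z \<noteq> 0"
      by (metis division_ring_divide_zero exp_not_eq_zero)
    then show ?thesis
      using eq by (simp add: field_simps)
  qed (use f0 in simp)
  then obtain E where "fps_nth E 0 = 1" "fps_deriv E = fps_deriv (fps_expansion w 0) * E"
    "fps_X * fps_deriv (fps_expansion f 0) = fps_expansion f 0 * E"
    using quotient_eq_exp_power_series [OF holf holw w0] by blast
  moreover have "?a 0 = 0" "?a 1 = 1"
    using A by (rule taylor_coeff_class_A)+
  moreover have "?a = fps_nth (fps_expansion f 0)" "?c = fps_nth (fps_expansion w 0)"
    by (simp_all add: taylor_coeff_def fun_eq_iff)
  ultimately have expansion:
    "hankel_det ?a 4 1 = (\<Sum>(q, ks)\<leftarrow>hankel_terms. of_real q * monomial ?c ks)"
    by (intro hankel_det_eq_sum_monomials)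
      (simp_all only: quotient_eq_exp_coefficients [of "fps_expansion f 0" E "fps_expansion w 0"])

  have bessel: "(norm (?c j))\<^sup>2 + (norm (?c k))\<^sup>2 \<le> 1" if "j \<noteq> k" for j k
  proof -
    have "norm (w z) \<le> 1" if "z \<in> unit_disc" for z
      using w_le [OF that] that by simp
    then have "(\<Sum>i\<in>{j, k}. (norm (?c i))\<^sup>2) \<le> 1"
      by (intro bessel_bounded_holomorphic holw) auto
    then show ?thesis
      using that by simp
  qed
  have "norm (hankel_det ?a 4 1) \<le> 7 / 40"
    unfolding expansion
    by (rule order_trans [OF norm_sum_monomials_le sum_weights_hankel_terms]) (rule bessel)
  also have "\<dots> \<le> 0.29059"
    by simp
  finally show ?thesis .
qed

end
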